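(* Let $G=(V,E)$ be a path graph and let $T$ be any transaction matrix on $V$. Then there is a fee assignment $f_E$ with $f_e\in\{0,1\}$ for every $e\in E$ such that $p(G,T,f_E)\ge p(G,T,f'_E)$ for every fee assignment $f'_E\in[0,1]^E$. That is, the optimal profit on a given path can always be achieved by assigning to each edge a fee of $0$ or $1$.
   Context: A transaction matrix on a vertex set $V$ with $|V|=n$ is a symmetric matrix $T\in\mathbb{N}^{n\times n}$ ($0\in\mathbb{N}$) with zero diagonal; $T[i,j]$ is the number of transactions between $i$ and $j$ (in either direction). A payment network is a finite undirected graph $G=(V,E)$ with $m=|E|$. A fee assignment $f_E$ gives each edge $e\in E$ a real fee $f_e$ with $0\le f_e\le 1$ (the value $1$ is the cost of a transaction on the blockchain). For $i,j\in V$, $path(i,j)$ denotes the edge set of a cheapest path from $i$ to $j$ in $G$, i.e., one minimizing the sum of the fees of its edges (in a path graph this is the unique path from $i$ to $j$). The profit is $$p(G,T,f_E)=-m+\sum_{i,j\in V}\ \sum_{e\in path(i,j)} f_e\cdot X_{ij}\cdot T[i,j],$$ where $X_{ij}=1$ if $\sum_{e\in path(i,j)}f_e\le 1$ and $X_{ij}=0$ otherwise. (It is not required that all transactions use the network.) *)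

theory Defs
  imports Complex_Main
begin

text \<open>
  A finite simple undirected graph is a pair of a vertex set \<open>V\<close> and a set \<open>E\<close> of
  two-element subsets of \<open>V\<close>. Paths are nonempty lists of distinct vertices.
\<close>

definition payment_network :: "'v set \<Rightarrow> 'v set set \<Rightarrow> bool" where
  "payment_network V E \<longleftrightarrow> finite V \<and> (\<forall>e\<in>E. \<exists>u\<in>V. \<exists>v\<in>V. u \<noteq> v \<and> e = {u, v})"

definition path_edges :: "'v list \<Rightarrow> 'v set set" where
  "path_edges p = {{p ! k, p ! Suc k} | k. Suc k < length p}"

definition path_graph :: "'v set \<Rightarrow> 'v set set \<Rightarrow> bool" where
  "path_graph V E \<longleftrightarrow> (\<exists>p. p \<noteq> [] \<and> distinct p \<and> V = set p \<and> E = path_edges p)"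

definition is_path :: "'v set \<Rightarrow> 'v set set \<Rightarrow> 'v \<Rightarrow> 'v \<Rightarrow> 'v list \<Rightarrow> bool" where
  "is_path V E i j p \<longleftrightarrow>
     p \<noteq> [] \<and> distinct p \<and> set p \<subseteq> V \<and> path_edges p \<subseteq> E \<and> hd p = i \<and> last p = j"

definition transaction_matrix :: "'v set \<Rightarrow> ('v \<Rightarrow> 'v \<Rightarrow> nat) \<Rightarrow> bool" where
  "transaction_matrix V T \<longleftrightarrow> (\<forall>i\<in>V. \<forall>j\<in>V. T i j = T j i) \<and> (\<forall>i\<in>V. T i i = 0)"

definition fee_assignment :: "'v set set \<Rightarrow> ('v set \<Rightarrow> real) \<Rightarrow> bool" where
  "fee_assignment E f \<longleftrightarrow> (\<forall>e\<in>E. 0 \<le> f e \<and> f e \<le> 1)"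

definition is_cheapest_path ::
  "'v set \<Rightarrow> 'v set set \<Rightarrow> ('v set \<Rightarrow> real) \<Rightarrow> 'v \<Rightarrow> 'v \<Rightarrow> 'v list \<Rightarrow> bool" where
  "is_cheapest_path V E f i j p \<longleftrightarrow> is_path V E i j p \<and>
     (\<forall>q. is_path V E i j q \<longrightarrow> sum f (path_edges p) \<le> sum f (path_edges q))"

text \<open>
  The choice among equally cheap paths is arbitrary; it does not affect the profit, which
  depends only on the total fee (see \<open>sum_cheapest_path\<close> below).
\<close>

definition cheapest_path ::
  "'v set \<Rightarrow> 'v set set \<Rightarrow> ('v set \<Rightarrow> real) \<Rightarrow> 'v \<Rightarrow> 'v \<Rightarrow> 'v set set" where
  "cheapest_path V E f i j = path_edges (SOME p. is_cheapest_path V E f i j p)"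

text \<open>
  Vertices not joined by any path cannot use the network, so the indicator is \<open>0\<close> for them;
  this case does not occur in a connected graph.
\<close>

definition uses_network ::
  "'v set \<Rightarrow> 'v set set \<Rightarrow> ('v set \<Rightarrow> real) \<Rightarrow> 'v \<Rightarrow> 'v \<Rightarrow> real" where
  "uses_network V E f i j =
     (if (\<exists>p. is_path V E i j p) \<and> (\<Sum>e\<in>cheapest_path V E f i j. f e) \<le> 1 then 1 else 0)"

text \<open>The sum ranges over ordered pairs, so each unordered pair of vertices contributes twice.\<close>

definition profit ::
  "'v set \<Rightarrow> 'v set set \<Rightarrow> ('v \<Rightarrow> 'v \<Rightarrow> nat) \<Rightarrow> ('v set \<Rightarrow> real) \<Rightarrow> real" where
  "profit V E T f = - real (card E) +
     (\<Sum>i\<in>V. \<Sum>j\<in>V. \<Sum>e\<in>cheapest_path V E f i j.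
        f e * uses_network V E f i j * real (T i j))"

lemma path_graph_imp_payment_network:
  assumes "path_graph V E"
  shows "payment_network V E"
proof -
  obtain p where p: "distinct p" "V = set p" "E = path_edges p"
    using assms by (auto simp: path_graph_def)
  have "\<exists>u\<in>V. \<exists>v\<in>V. u \<noteq> v \<and> e = {u, v}" if e: "e \<in> E" for e
  proof -
    obtain k where k: "Suc k < length p" "e = {p ! k, p ! Suc k}"
      using e unfolding p(3) path_edges_def by blast
    then have "p ! k \<noteq> p ! Suc k"
      using p(1) by (simp add: nth_eq_iff_index_eq)
    moreover have "p ! k \<in> V" "p ! Suc k \<in> V"
      using k p(2) by auto
    ultimately show ?thesis using k by blast
  qed
  then show ?thesis by (simp add: payment_network_def p(2))
qed

lemma cheapest_path_exists:
  assumes "finite V" "is_path V E i j p"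
  shows "\<exists>p. is_cheapest_path V E f i j p"
proof -
  let ?P = "{p. is_path V E i j p}"
  have "finite ?P"
    by (rule finite_subset[OF _ finite_subset_distinct[OF assms(1)]]) (auto simp: is_path_def)
  moreover have "?P \<noteq> {}" using assms(2) by auto
  ultimately obtain q where "is_arg_min (\<lambda>p. sum f (path_edges p)) (\<lambda>p. p \<in> ?P) q"
    using ex_is_arg_min_if_finite by blast
  then have "is_cheapest_path V E f i j q"
    by (auto simp: is_arg_min_linorder is_cheapest_path_def)
  then show ?thesis ..
qed

lemma sum_cheapest_path:
  assumes "is_cheapest_path V E f i j p"
  shows "sum f (cheapest_path V E f i j) = sum f (path_edges p)"
proof -
  have "is_cheapest_path V E f i j (SOME q. is_cheapest_path V E f i j q)"
    using assms by (rule someI)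
  with assms show ?thesis
    unfolding cheapest_path_def is_cheapest_path_def by (meson order_antisym)
qed

end

theory Submission
  imports Defs "HOL-Analysis.Analysis"
begin

text \<open>
  Number the vertices along the path and let \<open>S k\<close> be the sum of the first \<open>k\<close> fees, so that the
  cost between positions \<open>a\<close> and \<open>b\<close> is \<open>\<bar>S b - S a\<bar>\<close>. Shift by \<open>t \<in> [0,1]\<close> and round: the edge
  from \<open>k\<close> to \<open>k + 1\<close> receives the fee \<open>\<lfloor>S (k + 1) + t\<rfloor> - \<lfloor>S k + t\<rfloor>\<close>, which is \<open>0\<close> or \<open>1\<close>.
  A pair of cost at most \<open>1\<close> keeps rounded cost at most \<open>1\<close>, hence keeps using the network, and since
  \<open>\<lfloor>x + t\<rfloor>\<close> has mean \<open>x\<close> over \<open>t\<close>, its mean rounded cost is its original cost. So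
  the mean profit of the rounded assignments is at least the original profit, and the best of the
  finitely many \<open>0\<close>/\<open>1\<close> assignments is optimal.
\<close>

section \<open>Paths in a path graph\<close>

definition nth_edge :: "'v list \<Rightarrow> nat \<Rightarrow> 'v set" where
  "nth_edge p k = {p ! k, p ! Suc k}"

lemma path_edges_eq_image: "path_edges p = nth_edge p ` {..<length p - 1}"
  by (auto simp: path_edges_def nth_edge_def image_iff)

lemma finite_path_edges: "finite (path_edges p)"
  by (simp add: path_edges_eq_image)

lemma inj_on_nth_edge:
  assumes "distinct p"
  shows "inj_on (nth_edge p) {..<length p - 1}"
proof (rule inj_onI)
  fix k l assume kl: "k \<in> {..<length p - 1}" "l \<in> {..<length p - 1}"
    and "nth_edge p k = nth_edge p l"
  then consider "p ! k = p ! l" | "p ! k = p ! Suc l" "p ! Suc k = p ! l"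
    by (auto simp: nth_edge_def doubleton_eq_iff)
  then show "k = l"
    by cases (use assms kl in \<open>auto simp: nth_eq_iff_index_eq\<close>)
qed

lemma path_edges_rev: "path_edges (rev p) = path_edges p"
proof -
  have "path_edges (rev p) \<subseteq> path_edges p" for p :: "'a list"
  proof
    fix e assume "e \<in> path_edges (rev p)"
    then obtain k where k: "Suc k < length p" "e = {rev p ! k, rev p ! Suc k}"
      by (auto simp: path_edges_def)
    \<comment> \<open>Reversal sends edge \<open>k\<close> to edge \<open>length p - 2 - k\<close>
      with its endpoints swapped.\<close>
    define l where "l = length p - Suc (Suc k)"
    have "Suc l < length p" "rev p ! k = p ! Suc l" "rev p ! Suc k = p ! l"
      using k(1) by (auto simp: l_def rev_nth Suc_diff_Suc)
    then show "e \<in> path_edges p"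
      using k(2) by (auto simp: path_edges_def insert_commute)
  qed
  from this[of p] this[of "rev p"] show ?thesis by simp
qed

text \<open>\<open>take (Suc b)\<close> keeps the vertex at position \<open>b\<close>. Edges are
  indexed by their left ends, hence the half-open range.\<close>

lemma path_edges_slice:
  assumes "a \<le> b" "b < length p"
  shows "path_edges (drop a (take (Suc b) p)) = nth_edge p ` {a..<b}"
proof -
  have "path_edges (drop a (take (Suc b) p)) = (\<lambda>k. nth_edge p (a + k)) ` {..<b - a}"
    using assms by (auto simp: path_edges_eq_image nth_edge_def image_iff min_def)
  also have "\<dots> = nth_edge p ` ((+) a ` {..<b - a})"
    by (simp add: image_image)
  also have "(+) a ` {..<b - a} = {a..<b}"
    using assms by (simp add: lessThan_atLeast0)
  finally show ?thesis .
qed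

lemma slice_is_path:
  assumes "distinct p" "a \<le> b" "b < length p"
  shows "is_path (set p) (path_edges p) (p ! a) (p ! b) (drop a (take (Suc b) p))"
  unfolding is_path_def
proof (intro conjI)
  show "path_edges (drop a (take (Suc b) p)) \<subseteq> path_edges p"
    using assms unfolding path_edges_slice[OF assms(2,3)] unfolding path_edges_eq_image by auto
  show "set (drop a (take (Suc b) p)) \<subseteq> set p"
    by (meson order_trans set_drop_subset set_take_subset)
  show "last (drop a (take (Suc b) p)) = p ! b"
    using assms by (simp add: take_Suc_conv_app_nth)
qed (use assms in \<open>auto simp: hd_drop_conv_nth\<close>)

lemma is_path_rev: "is_path V E i j p \<Longrightarrow> is_path V E j i (rev p)"
  by (auto simp: is_path_def path_edges_rev hd_rev last_rev)

lemma ex_path_between: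
  assumes "distinct p" "a < length p" "b < length p"
  shows "\<exists>q. is_path (set p) (path_edges p) (p ! a) (p ! b) q \<and>
             path_edges q = nth_edge p ` {min a b..<max a b}"
proof (cases "a \<le> b")
  case True
  then show ?thesis
    using assms slice_is_path path_edges_slice by (metis max_absorb2 min_absorb1)
next
  case False
  then have "b \<le> a" by simp
  then show ?thesis
    using assms slice_is_path[of p b a] path_edges_slice[of b a p] is_path_rev path_edges_rev
    by (metis max_absorb1 min_absorb2)
qed

text \<open>A discrete intermediate value argument: if \<open>P\<close> never changed between
  neighbours, it would be constant along \<open>q\<close>.\<close>

lemma ex_consecutive_differ:
  assumes "q \<noteq> []" "P (hd q) \<noteq> P (last q)"
  shows "\<exists>k. Suc k < length q \<and> P (q ! k) \<noteq> P (q ! Suc k)"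
proof (rule ccontr)
  assume *: "\<not> ?thesis"
  have "P (q ! k) = P (q ! 0)" if "k < length q" for k
    using that * by (induction k) auto
  from this[of "length q - 1"] assms show False
    by (simp add: hd_conv_nth last_conv_nth)
qed

text \<open>A path crosses every cut \<open>{0..k}\<close> separating its endpoints, and only edge \<open>k\<close> does.\<close>

lemma path_edges_between_subset:
  assumes "distinct p" "a < length p" "b < length p"
    and q: "is_path (set p) (path_edges p) (p ! a) (p ! b) q"
  shows "nth_edge p ` {min a b..<max a b} \<subseteq> path_edges q"
proof
  fix e assume "e \<in> nth_edge p ` {min a b..<max a b}"
  then obtain k where k: "min a b \<le> k" "k < max a b" "e = nth_edge p k" by auto
  define P where "P v \<longleftrightarrow> v \<in> (!) p ` {..k}" for v
  have klt: "k < length p - 1"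
    using k assms by auto
  have P_nth: "P (p ! c) \<longleftrightarrow> c \<le> k" if "c < length p" for c
    using that klt assms(1) by (auto simp: P_def nth_eq_iff_index_eq)
  have "P (hd q) \<noteq> P (last q)"
    using q k assms P_nth by (auto simp: is_path_def min_def max_def split: if_splits)
  then obtain l where l: "Suc l < length q" "P (q ! l) \<noteq> P (q ! Suc l)"
    using ex_consecutive_differ[of q P] q by (auto simp: is_path_def)
  then have in_q: "{q ! l, q ! Suc l} \<in> path_edges q"
    by (auto simp: path_edges_def)
  then obtain m where m: "m < length p - 1" "{q ! l, q ! Suc l} = nth_edge p m"
    using q by (auto simp: is_path_def path_edges_eq_image)
  then have "P (p ! m) \<noteq> P (p ! Suc m)"
    using l(2) by (auto simp: nth_edge_def doubleton_eq_iff)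
  then have "(m \<le> k) \<noteq> (Suc m \<le> k)"
    using m(1) P_nth[of m] P_nth[of "Suc m"] by auto
  then have "m = k" by linarith
  then show "e \<in> path_edges q"
    using in_q m k by simp
qed

section \<open>Profit in terms of prefix sums\<close>

definition prefix_fee :: "'v list \<Rightarrow> ('v set \<Rightarrow> real) \<Rightarrow> nat \<Rightarrow> real" where
  "prefix_fee p f k = (\<Sum>l<k. f (nth_edge p l))"

lemma sum_fee_between:
  assumes "distinct p" "fee_assignment (path_edges p) f" "a < length p" "b < length p"
  shows "sum f (nth_edge p ` {min a b..<max a b}) = \<bar>prefix_fee p f b - prefix_fee p f a\<bar>"
proof -
  let ?I = "{min a b..<max a b}"
  have sub: "?I \<subseteq> {..<length p - 1}"
    using assms by auto
  have "sum f (nth_edge p ` ?I) = (\<Sum>k\<in>?I. f (nth_edge p k))"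
    using inj_on_subset[OF inj_on_nth_edge[OF assms(1)] sub] by (simp add: sum.reindex)
  also have "\<dots> = prefix_fee p f (max a b) - prefix_fee p f (min a b)"
    unfolding prefix_fee_def using sum_diff_nat_ivl[of 0 "min a b" "max a b" "\<lambda>k. f (nth_edge p k)"]
    by (simp add: lessThan_atLeast0)
  finally have eq: "sum f (nth_edge p ` ?I) = \<dots>" .
  \<comment> \<open>Nonnegative fees make the prefix sums monotone between the two positions, so
    their difference, taken from the smaller to the larger position, is the absolute value.\<close>
  have "0 \<le> sum f (nth_edge p ` ?I)"
    using assms(2) sub by (intro sum_nonneg) (auto simp: fee_assignment_def path_edges_eq_image)
  with eq show ?thesis
    by (cases "a \<le> b") (auto simp: max_def min_def)
qed

text \<open>The fee earned from one transaction whose cheapest path costs \<open>c\<close>; beyond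
  the blockchain cost 1 it bypasses the network.\<close>

definition revenue :: "real \<Rightarrow> real" where
  "revenue c = (if c \<le> 1 then c else 0)"

text \<open>Every path between two vertices contains the edges of the direct one, and fees are
  nonnegative, so the direct path is cheapest. Hence the fees enter the profit only through prefix
  sums.\<close>

lemma profit_path_graph:
  assumes p: "distinct p" and f: "fee_assignment (path_edges p) f"
  shows "profit (set p) (path_edges p) T f = - real (card (path_edges p)) +
    (\<Sum>a<length p. \<Sum>b<length p.
       revenue \<bar>prefix_fee p f b - prefix_fee p f a\<bar> * real (T (p ! a) (p ! b)))"
proof -
  let ?V = "set p" and ?E = "path_edges p"
  let ?t = "\<lambda>i j. \<Sum>e\<in>cheapest_path ?V ?E f i j. f e * uses_network ?V ?E f i j * real (T i j)"
  have term_eq: "?t (p ! a) (p ! b) =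
      revenue \<bar>prefix_fee p f b - prefix_fee p f a\<bar> * real (T (p ! a) (p ! b))"
    if ab: "a < length p" "b < length p" for a b
  proof -
    obtain q where q: "is_path ?V ?E (p ! a) (p ! b) q"
      "path_edges q = nth_edge p ` {min a b..<max a b}"
      using ex_path_between[OF p ab] by blast
    have "sum f (path_edges q) \<le> sum f (path_edges r)" if "is_path ?V ?E (p ! a) (p ! b) r" for r
      using path_edges_between_subset[OF p ab that] f that q(2)
      by (intro sum_mono2) (auto simp: fee_assignment_def is_path_def finite_path_edges)
    then have "is_cheapest_path ?V ?E f (p ! a) (p ! b) q"
      using q by (simp add: is_cheapest_path_def)
    then have "sum f (cheapest_path ?V ?E f (p ! a) (p ! b)) =
        \<bar>prefix_fee p f b - prefix_fee p f a\<bar>"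
      using sum_fee_between[OF p f ab] q by (simp add: sum_cheapest_path)
    then show ?thesis
      using q(1) unfolding sum_distrib_right[symmetric]
      by (auto simp: uses_network_def revenue_def)
  qed
  have bij: "bij_betw ((!) p) {..<length p} ?V"
    by (rule bij_betw_nth[OF p]) auto
  have "(\<Sum>i\<in>?V. \<Sum>j\<in>?V. ?t i j) = (\<Sum>a<length p. \<Sum>b<length p. ?t (p ! a) (p ! b))"
    by (simp add: sum.reindex_bij_betw[OF bij, symmetric])
  then show ?thesis
    unfolding profit_def by (simp add: term_eq)
qed

section \<open>Shifted rounding\<close>

text \<open>On [0,1] the integrand is a step function: it jumps from the floor of \<open>x\<close>
  to the next integer at \<open>t = 1 - frac x\<close>, so the upper step has length
  \<open>frac x\<close>.\<close>

lemma has_integral_floor_shift: "((\<lambda>t. real_of_int \<lfloor>x + t\<rfloor>) has_integral x) {0..1}"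
proof -
  have "((\<lambda>t. 1 :: real) has_integral frac x) {1 - frac x..1}"
    using has_integral_const_real[of "1 :: real" "1 - frac x" 1] by (simp add: frac_ge_0)
  then have "((\<lambda>t. if t \<in> {1 - frac x..1} then 1 else 0 :: real) has_integral frac x) {0..1}"
    using frac_lt_1[of x] by (subst has_integral_restrict) auto
  moreover have "((\<lambda>t. real_of_int \<lfloor>x\<rfloor>) has_integral real_of_int \<lfloor>x\<rfloor>) {0..1 :: real}"
    using has_integral_const_real[of "real_of_int \<lfloor>x\<rfloor>" 0 1] by simp
  ultimately have "((\<lambda>t. real_of_int \<lfloor>x\<rfloor> + (if t \<in> {1 - frac x..1} then 1 else 0))
      has_integral (real_of_int \<lfloor>x\<rfloor> + frac x)) {0..1}"
    by (intro has_integral_add)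
  moreover have "real_of_int \<lfloor>x\<rfloor> + (if t \<in> {1 - frac x..1} then 1 else 0) = real_of_int \<lfloor>x + t\<rfloor>"
    if "t \<in> {0..1}" for t
  proof (cases "1 - frac x \<le> t")
    case True
    then have "\<lfloor>x + t\<rfloor> = \<lfloor>x\<rfloor> + 1"
      using that unfolding frac_def atLeastAtMost_iff by linarith
    then show ?thesis using True that by simp
  next
    case False
    then have "\<lfloor>x + t\<rfloor> = \<lfloor>x\<rfloor>"
      using that unfolding frac_def atLeastAtMost_iff by linarith
    then show ?thesis using False by simp
  qed
  ultimately have "((\<lambda>t. real_of_int \<lfloor>x + t\<rfloor>) has_integral (real_of_int \<lfloor>x\<rfloor> + frac x)) {0..1}"
    by (rule has_integral_eq[rotated])
  then show ?thesis by (simp add: frac_def)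
qed

text \<open>Rounding is monotone, so the rounded difference never takes the opposite sign and the
  absolute value commutes with averaging.\<close>

lemma has_integral_abs_floor_shift_diff:
  "((\<lambda>t. real_of_int \<bar>\<lfloor>y + t\<rfloor> - \<lfloor>x + t\<rfloor>\<bar>) has_integral \<bar>y - x\<bar>) {0..1}"
proof -
  have "((\<lambda>t. real_of_int \<lfloor>max x y + t\<rfloor> - real_of_int \<lfloor>min x y + t\<rfloor>)
      has_integral (max x y - min x y)) {0..1}"
    by (intro has_integral_diff has_integral_floor_shift)
  moreover have "real_of_int \<lfloor>max x y + t\<rfloor> - real_of_int \<lfloor>min x y + t\<rfloor> =
      real_of_int \<bar>\<lfloor>y + t\<rfloor> - \<lfloor>x + t\<rfloor>\<bar>" for t
    using floor_mono[of "x + t" "y + t"] floor_mono[of "y + t" "x + t"]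
    by (auto simp: max_def min_def)
  moreover have "max x y - min x y = \<bar>y - x\<bar>" by auto
  ultimately show ?thesis by simp
qed

text \<open>The floors differ by less than 2, hence by at most 1 as integers. This is where the
  threshold being an integer matters.\<close>

lemma abs_floor_shift_diff_le_1:
  fixes x y t :: real
  assumes "\<bar>y - x\<bar> \<le> 1"
  shows "\<bar>\<lfloor>y + t\<rfloor> - \<lfloor>x + t\<rfloor>\<bar> \<le> 1"
  using assms by linarith

text \<open>The set of edges that get fee 1; its indicator is the rounded fee assignment.\<close>

definition rounded_edges :: "'v list \<Rightarrow> ('v set \<Rightarrow> real) \<Rightarrow> real \<Rightarrow> 'v set set" where
  "rounded_edges p f t = nth_edge p ` {k. k < length p - 1 \<and>
     \<lfloor>prefix_fee p f (Suc k) + t\<rfloor> \<noteq> \<lfloor>prefix_fee p f k + t\<rfloor>}"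

text \<open>Each original fee lies in [0,1], so the rounded prefix sum increases by 0 or 1 per edge
  and the indicators telescope. Subtracting the floor of \<open>t\<close> makes the sum start at
  0.\<close>

lemma prefix_fee_rounded:
  assumes p: "distinct p" and f: "fee_assignment (path_edges p) f" and "k < length p"
  shows "prefix_fee p (indicat_real (rounded_edges p f t)) k =
    real_of_int (\<lfloor>prefix_fee p f k + t\<rfloor> - \<lfloor>t\<rfloor>)"
  using \<open>k < length p\<close>
proof (induction k)
  case 0
  then show ?case by (simp add: prefix_fee_def)
next
  case (Suc k)
  then have k: "k < length p - 1" by simp
  have "nth_edge p k \<in> rounded_edges p f t \<longleftrightarrow>
      \<lfloor>prefix_fee p f (Suc k) + t\<rfloor> \<noteq> \<lfloor>prefix_fee p f k + t\<rfloor>"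
    unfolding rounded_edges_def
    by (subst inj_on_image_mem_iff[OF inj_on_nth_edge[OF p]]) (use k in auto)
  moreover have "0 \<le> f (nth_edge p k)" "f (nth_edge p k) \<le> 1"
    using f k by (auto simp: fee_assignment_def path_edges_eq_image)
  then have "\<lfloor>prefix_fee p f (Suc k) + t\<rfloor> = \<lfloor>prefix_fee p f k + t\<rfloor> \<or>
      \<lfloor>prefix_fee p f (Suc k) + t\<rfloor> = \<lfloor>prefix_fee p f k + t\<rfloor> + 1"
    unfolding prefix_fee_def sum.lessThan_Suc by linarith
  ultimately have "indicat_real (rounded_edges p f t) (nth_edge p k) =
      real_of_int (\<lfloor>prefix_fee p f (Suc k) + t\<rfloor> - \<lfloor>prefix_fee p f k + t\<rfloor>)"
    by (auto simp: indicator_def)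
  then show ?case
    using Suc by (simp add: prefix_fee_def)
qed

lemma fee_assignment_indicator: "fee_assignment E (indicat_real A)"
  by (simp add: fee_assignment_def indicator_def)

lemma profit_le_of_rounded:
  assumes p: "distinct p" and f: "fee_assignment (path_edges p) f"
    and M: "\<And>t. profit (set p) (path_edges p) T (indicat_real (rounded_edges p f t)) \<le> M"
  shows "profit (set p) (path_edges p) T f \<le> M"
proof -
  let ?S = "prefix_fee p f" and ?n = "length p" and ?m = "real (card (path_edges p))"
  let ?w = "\<lambda>a b. real (T (p ! a) (p ! b))"
  \<comment> \<open>Eligibility is decided by the original cost, not the rounded one. This makes the
    mean over \<open>t\<close> exactly the original revenue, while pairs that become eligible only
    by rounding are dropped, which leaves a lower bound.\<close>
  let ?R = "\<lambda>t a b. if \<bar>?S b - ?S a\<bar> \<le> 1 then real_of_int \<bar>\<lfloor>?S b + t\<rfloor> - \<lfloor>?S a + t\<rfloor>\<bar> else 0"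
  have "((\<lambda>t. ?R t a b * ?w a b) has_integral (revenue \<bar>?S b - ?S a\<bar> * ?w a b)) {0..1}" for a b
    using has_integral_mult_left[OF has_integral_abs_floor_shift_diff[of "?S b" "?S a"], of "?w a b"]
    by (simp add: revenue_def)
  then have "((\<lambda>t. \<Sum>a<?n. \<Sum>b<?n. ?R t a b * ?w a b) has_integral
      (\<Sum>a<?n. \<Sum>b<?n. revenue \<bar>?S b - ?S a\<bar> * ?w a b)) {0..1}"
    by (intro has_integral_sum) auto
  then have int: "((\<lambda>t. \<Sum>a<?n. \<Sum>b<?n. ?R t a b * ?w a b) has_integral
      (profit (set p) (path_edges p) T f + ?m)) {0..1}"
    by (simp add: profit_path_graph[OF p f])
  have bound: "(\<Sum>a<?n. \<Sum>b<?n. ?R t a b * ?w a b) \<le> M + ?m" for t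
  proof -
    let ?g = "indicat_real (rounded_edges p f t)"
    have "?R t a b \<le> revenue \<bar>prefix_fee p ?g b - prefix_fee p ?g a\<bar>"
      if "a < ?n" "b < ?n" for a b
    proof -
      have "\<bar>prefix_fee p ?g b - prefix_fee p ?g a\<bar> = real_of_int \<bar>\<lfloor>?S b + t\<rfloor> - \<lfloor>?S a + t\<rfloor>\<bar>"
        using that by (simp add: prefix_fee_rounded[OF p f])
      then show ?thesis
        using abs_floor_shift_diff_le_1[of "?S b" "?S a" t] by (auto simp: revenue_def)
    qed
    then have "(\<Sum>a<?n. \<Sum>b<?n. ?R t a b * ?w a b) \<le>
        (\<Sum>a<?n. \<Sum>b<?n. revenue \<bar>prefix_fee p ?g b - prefix_fee p ?g a\<bar> * ?w a b)"
      by (intro sum_mono mult_right_mono) auto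
    with M[of t] show ?thesis
      by (simp add: profit_path_graph[OF p fee_assignment_indicator])
  qed
  have "((\<lambda>t. M + ?m) has_integral (M + ?m)) {0..1 :: real}"
    using has_integral_const_real[of "M + ?m" 0 1] by simp
  from has_integral_le[OF int this bound] show ?thesis by simp
qed

theorem lemma1:
  fixes V :: "'v set" and E :: "'v set set" and T :: "'v \<Rightarrow> 'v \<Rightarrow> nat"
  assumes "path_graph V E"
    and "transaction_matrix V T"
  shows "\<exists>f. fee_assignment E f \<and> (\<forall>e\<in>E. f e = 0 \<or> f e = 1) \<and>
           (\<forall>f'. fee_assignment E f' \<longrightarrow> profit V E T f \<ge> profit V E T f')"
proof -
  obtain p where p: "distinct p" and V: "V = set p" and E: "E = path_edges p"
    using assms(1) by (auto simp: path_graph_def)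
  \<comment> \<open>Subsets of \<open>E\<close> encode the 0/1 assignments on \<open>E\<close>, so a
    best one exists by finiteness; its profit serves as the bound \<open>M\<close> for all
    roundings.\<close>
  let ?P = "\<lambda>A. profit V E T (indicat_real A)"
  have "finite (?P ` Pow E)" "?P ` Pow E \<noteq> {}"
    by (auto simp: E finite_path_edges)
  from Max_in[OF this] obtain A where "?P A = Max (?P ` Pow E)"
    by auto
  then have best: "?P B \<le> ?P A" if "B \<subseteq> E" for B
    using that \<open>finite (?P ` Pow E)\<close> by simp
  have "profit V E T f' \<le> ?P A" if "fee_assignment E f'" for f'
  proof -
    have "rounded_edges p f' t \<subseteq> E" for t
      by (auto simp: E path_edges_eq_image rounded_edges_def)
    then show ?thesis
      using profit_le_of_rounded[OF p that[unfolded E]] best unfolding V E by blast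
  qed
  moreover have "\<forall>e\<in>E. indicat_real A e = 0 \<or> indicat_real A e = 1"
    by (simp add: indicator_def)
  ultimately show ?thesis
    using fee_assignment_indicator by blast
qed

end
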